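(* Let $\alpha:I\to E^3$ be a Frenet curve having an evolute-direction curve $\beta$. The following statements are equivalent: (i) $\alpha$ is a helix. (ii) $\alpha$ is an involute-donor curve of a slant helix. (iii) An evolute-direction curve of $\alpha$ is a slant helix.
   Context: $I\subset\mathbb{R}$ is an open interval and curves are smooth. A unit speed curve $\alpha:I\to E^3$ is a Frenet curve if its curvature $\kappa=\|\alpha''\|$ is nowhere zero; then $T=\alpha'$, $N=\alpha''/\kappa$, $B=T\times N$, and $T'=\kappa N$, $N'=-\kappa T+\tau B$, $B'=-\tau N$, where $\tau$ is the torsion. For a unit vector field $X(s)=a(s)T(s)+b(s)N(s)+c(s)B(s)$ with $a,b,c$ smooth and $a^2+b^2+c^2=1$, an $X$-direction curve of $\alpha$ is a curve $\beta:I\to E^3$ with $\beta'(s)=X(s)$; the parameter $s$ is then also arc length for $\beta$, whose Frenet apparatus is $\{\overline T,\overline N,\overline B\},\overline\kappa,\overline\tau$. An $X$-direction curve $\beta$ of $\alpha$ (for some such $X$) is called an evolute-direction curve of $\alpha$ if it is an evolute of $\alpha$, in the sense that $\beta$ is a Frenet curve with $\langle\overline T,T\rangle=0$ and $\overline N=T$ at each common parameter value $s$; then $\alpha$ is called an involute-donor curve of $\beta$. A Frenet curve is a (general) helix if $\tau/\kappa$ is constant. A Frenet curve is a slant helix if its principal normal vectors make a constant angle with a fixed direction; equivalently, $\frac{\kappa^2}{(\kappa^2+\tau^2)^{3/2}}\left(\frac{\tau}{\kappa}\right)'$ is constant. *)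

theory Defs
  imports "HOL-Analysis.Analysis"
begin

unbundle cross3_syntax

text \<open>
  Curves in \<open>E\<^sup>3\<close> on an interval \<open>I\<close> are total functions \<open>real \<Rightarrow> real ^ 3\<close>. Every notion below only
  looks at parameters in \<open>I\<close>; since \<open>I\<close> is always open, derivatives at points of \<open>I\<close> do not depend on
  the values outside \<open>I\<close>.
\<close>

definition D :: "(real \<Rightarrow> 'a::real_normed_vector) \<Rightarrow> real \<Rightarrow> 'a" where
  "D f = (\<lambda>s. vector_derivative f (at s))"

definition smooth :: "real set \<Rightarrow> (real \<Rightarrow> 'a::real_normed_vector) \<Rightarrow> bool" where
  "smooth I f \<longleftrightarrow> (\<forall>n. \<forall>s\<in>I. (D ^^ n) f differentiable (at s))"

definition open_interval :: "real set \<Rightarrow> bool" where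
  "open_interval I \<longleftrightarrow> open I \<and> is_interval I \<and> I \<noteq> {}"

text \<open>The Frenet apparatus below is meaningful only for unit speed curves.\<close>

definition tangent :: "(real \<Rightarrow> real ^ 3) \<Rightarrow> real \<Rightarrow> real ^ 3" where
  "tangent \<alpha> = D \<alpha>"

definition curvature :: "(real \<Rightarrow> real ^ 3) \<Rightarrow> real \<Rightarrow> real" where
  "curvature \<alpha> s = norm (D (D \<alpha>) s)"

definition normal :: "(real \<Rightarrow> real ^ 3) \<Rightarrow> real \<Rightarrow> real ^ 3" where
  "normal \<alpha> s = D (D \<alpha>) s /\<^sub>R curvature \<alpha> s"

definition binormal :: "(real \<Rightarrow> real ^ 3) \<Rightarrow> real \<Rightarrow> real ^ 3" where
  "binormal \<alpha> s = tangent \<alpha> s \<times> normal \<alpha> s"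

text \<open>The torsion is the coefficient in \<open>B' = - \<tau> N\<close>, read off with \<open>N \<bullet> N = 1\<close>.\<close>

definition torsion :: "(real \<Rightarrow> real ^ 3) \<Rightarrow> real \<Rightarrow> real" where
  "torsion \<alpha> s = - (D (binormal \<alpha>) s \<bullet> normal \<alpha> s)"

definition frenet_curve :: "real set \<Rightarrow> (real \<Rightarrow> real ^ 3) \<Rightarrow> bool" where
  "frenet_curve I \<alpha> \<longleftrightarrow>
     smooth I \<alpha> \<and> (\<forall>s\<in>I. norm (D \<alpha> s) = 1) \<and> (\<forall>s\<in>I. curvature \<alpha> s \<noteq> 0)"

definition unit_frenet_field ::
    "real set \<Rightarrow> (real \<Rightarrow> real ^ 3) \<Rightarrow> (real \<Rightarrow> real ^ 3) \<Rightarrow> bool" where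
  "unit_frenet_field I \<alpha> X \<longleftrightarrow>
     (\<exists>a b c. smooth I a \<and> smooth I b \<and> smooth I c \<and>
        (\<forall>s\<in>I. (a s)\<^sup>2 + (b s)\<^sup>2 + (c s)\<^sup>2 = 1 \<and>
               X s = a s *\<^sub>R tangent \<alpha> s + b s *\<^sub>R normal \<alpha> s + c s *\<^sub>R binormal \<alpha> s))"

text \<open>\<open>direction_curve I \<alpha> X \<beta>\<close>: \<open>\<beta>\<close> is an \<open>X\<close>-direction curve of \<open>\<alpha>\<close>.\<close>

definition direction_curve ::
    "real set \<Rightarrow> (real \<Rightarrow> real ^ 3) \<Rightarrow> (real \<Rightarrow> real ^ 3) \<Rightarrow> (real \<Rightarrow> real ^ 3) \<Rightarrow> bool" where
  "direction_curve I \<alpha> X \<beta> \<longleftrightarrow>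
     unit_frenet_field I \<alpha> X \<and> (\<forall>s\<in>I. (\<beta> has_vector_derivative X s) (at s))"

text \<open>\<open>evolute_direction_curve I \<alpha> \<beta>\<close>: \<open>\<beta>\<close> is an evolute-direction curve of \<open>\<alpha>\<close>.\<close>

definition evolute_direction_curve ::
    "real set \<Rightarrow> (real \<Rightarrow> real ^ 3) \<Rightarrow> (real \<Rightarrow> real ^ 3) \<Rightarrow> bool" where
  "evolute_direction_curve I \<alpha> \<beta> \<longleftrightarrow>
     (\<exists>X. direction_curve I \<alpha> X \<beta>) \<and> frenet_curve I \<beta> \<and>
     (\<forall>s\<in>I. tangent \<beta> s \<bullet> tangent \<alpha> s = 0 \<and> normal \<beta> s = tangent \<alpha> s)"

text \<open>\<open>involute_donor_curve I \<beta> \<alpha>\<close>: \<open>\<alpha>\<close> is an involute-donor curve of \<open>\<beta>\<close>.\<close>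

definition involute_donor_curve ::
    "real set \<Rightarrow> (real \<Rightarrow> real ^ 3) \<Rightarrow> (real \<Rightarrow> real ^ 3) \<Rightarrow> bool" where
  "involute_donor_curve I \<beta> \<alpha> \<longleftrightarrow> evolute_direction_curve I \<alpha> \<beta>"

definition helix :: "real set \<Rightarrow> (real \<Rightarrow> real ^ 3) \<Rightarrow> bool" where
  "helix I \<alpha> \<longleftrightarrow>
     frenet_curve I \<alpha> \<and> (\<exists>c. \<forall>s\<in>I. torsion \<alpha> s / curvature \<alpha> s = c)"

text \<open>
  The fixed direction is a unit vector \<open>u\<close>. As the principal normals are unit vectors as well, the
  angle they make with \<open>u\<close> is \<open>\<theta>\<close> exactly if the inner product is \<open>cos \<theta>\<close>.
\<close>

definition slant_helix :: "real set \<Rightarrow> (real \<Rightarrow> real ^ 3) \<Rightarrow> bool" where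
  "slant_helix I \<alpha> \<longleftrightarrow>
     frenet_curve I \<alpha> \<and>
     (\<exists>u \<theta>. norm u = 1 \<and> 0 \<le> \<theta> \<and> \<theta> \<le> pi \<and> (\<forall>s\<in>I. normal \<alpha> s \<bullet> u = cos \<theta>))"

end

theory Submission imports Defs begin

text \<open>
  The principal normal of an evolute-direction curve of \<open>\<alpha>\<close> is by definition the tangent \<open>T\<close> of
  \<open>\<alpha>\<close>. Such a curve is therefore a slant helix exactly if \<open>T\<close> makes a constant angle with some
  fixed direction \<open>u\<close>, a condition that mentions \<open>\<alpha>\<close> only. So either all evolute-direction curves
  of \<open>\<alpha>\<close> are slant helices or none is, and as there is at least one, the existential and the
  universal condition of the theorem coincide.

  What remains is Lancret's theorem: \<open>T\<close> has constant slope against some \<open>u\<close> if and only if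
  \<open>\<tau> / \<kappa>\<close> is constant. If \<open>\<tau> = c \<kappa>\<close>, then \<open>c T + B\<close> has derivative \<open>c \<kappa> N - \<tau> N = 0\<close>, so it is
  a constant vector, and \<open>T\<close> has inner product \<open>c\<close> with it (\<open>helix_imp_constant_slope\<close>).
  Conversely, if \<open>T \<bullet> u\<close> is a constant \<open>a\<close>, one differentiation gives \<open>N \<bullet> u = 0\<close>; then \<open>B \<bullet> u\<close> is
  a constant \<open>b\<close> because \<open>B'\<close> is a multiple of \<open>N\<close>, and differentiating \<open>N \<bullet> u = 0\<close> gives
  \<open>\<tau> b = \<kappa> a\<close> (\<open>constant_slope_imp_helix\<close>). Both directions rest on the equations of Frenet and
  Serret (\<open>frenet_serret\<close>).
\<close>

text \<open>
  With \<open>b = t \<times> n\<close>, expanding \<open>b \<times> (v \<times> b)\<close> by Lagrange's identity in two ways, at the outer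
  and at the inner product, gives the component of \<open>v\<close> orthogonal to \<open>b\<close> and its expression in
  \<open>t\<close> and \<open>n\<close>.
\<close>

lemma orthonormal_frame_expansion:
  fixes t n v :: "real ^ 3"
  assumes "t \<bullet> t = 1" "n \<bullet> n = 1" "t \<bullet> n = 0"
  shows "v = (v \<bullet> t) *\<^sub>R t + (v \<bullet> n) *\<^sub>R n + (v \<bullet> (t \<times> n)) *\<^sub>R (t \<times> n)"
    and "(t \<times> n) \<bullet> (t \<times> n) = 1"
    and "t \<times> (t \<times> n) = - n"
    and "(t \<times> n) \<times> n = - t"
    and "(t \<times> n) \<times> t = n"
proof -
  have bt: "(t \<times> n) \<times> t = n" and bn: "(t \<times> n) \<times> n = - t"
    using assms Lagrange[of t t n] Lagrange[of n t n]
    by (simp_all add: cross_skew[of "t \<times> n"] inner_commute)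
  show bb: "(t \<times> n) \<bullet> (t \<times> n) = 1"
    using assms by (simp add: dot_cross inner_commute)
  have "(t \<times> n) \<times> (v \<times> (t \<times> n)) = v - (v \<bullet> (t \<times> n)) *\<^sub>R (t \<times> n)"
    using bb by (simp add: Lagrange[of "t \<times> n"] inner_commute)
  moreover have "(t \<times> n) \<times> (v \<times> (t \<times> n)) = (v \<bullet> n) *\<^sub>R n + (v \<bullet> t) *\<^sub>R t"
    by (simp add: Lagrange[of v] cross_minus_right cross_mult_right left_diff_distrib
        right_diff_distrib bt bn cross_add_right diff_conv_add_uminus del: add_uminus_conv_diff)
  ultimately show "v = (v \<bullet> t) *\<^sub>R t + (v \<bullet> n) *\<^sub>R n + (v \<bullet> (t \<times> n)) *\<^sub>R (t \<times> n)"
    by (simp add: algebra_simps)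
  show "(t \<times> n) \<times> n = - t" "(t \<times> n) \<times> t = n" by (fact bn bt)+
  show "t \<times> (t \<times> n) = - n" using bt by (metis cross_skew)
qed

lemma smooth_imp_has_vector_derivative:
  assumes "smooth I f" "s \<in> I"
  shows "((D ^^ n) f has_vector_derivative (D ^^ Suc n) f s) (at s)"
  using assms unfolding smooth_def D_def
  by (simp add: vector_derivative_works[symmetric])

lemma has_vector_derivative_cross:
  fixes f g :: "real \<Rightarrow> real ^ 3"
  assumes "(f has_vector_derivative f') (at s)" "(g has_vector_derivative g') (at s)"
  shows "((\<lambda>x. f x \<times> g x) has_vector_derivative (f s \<times> g' + f' \<times> g s)) (at s)"
  using bounded_bilinear.has_vector_derivative[OF _ assms] bilinear_cross
  by (simp add: bilinear_conv_bounded_bilinear)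

lemma has_vector_derivative_inner:
  fixes f g :: "real \<Rightarrow> 'a::real_inner"
  assumes "(f has_vector_derivative f') (at s)" "(g has_vector_derivative g') (at s)"
  shows "((\<lambda>x. f x \<bullet> g x) has_vector_derivative (f s \<bullet> g' + f' \<bullet> g s)) (at s)"
  using bounded_bilinear.has_vector_derivative[OF bounded_bilinear_inner assms] .

lemma has_vector_derivative_eq_0_if_constant_on_open:
  assumes "open I" "s \<in> I" "\<And>x. x \<in> I \<Longrightarrow> f x = c"
    and "(f has_vector_derivative f') (at s)"
  shows "f' = 0"
proof -
  have "(f has_vector_derivative 0) (at s)"
    by (rule has_vector_derivative_transform_within_open[of "\<lambda>_. c" _ _ I]) (use assms in auto)
  then show ?thesis using assms(4) vector_derivative_unique_at by blast
qed

lemma constant_if_has_vector_derivative_0: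
  assumes "open_interval I" "\<And>s. s \<in> I \<Longrightarrow> (f has_vector_derivative 0) (at s)"
  obtains c where "\<And>s. s \<in> I \<Longrightarrow> f s = c"
proof -
  have "convex I" using assms(1) unfolding open_interval_def by (simp add: is_interval_convex)
  then show ?thesis
    using has_vector_derivative_zero_constant[of I f] assms(2) that
      has_vector_derivative_at_within by metis
qed

lemma frenet_frame_orthonormal:
  assumes "open I" "frenet_curve I \<alpha>" "s \<in> I"
  shows "tangent \<alpha> s \<bullet> tangent \<alpha> s = 1" "normal \<alpha> s \<bullet> normal \<alpha> s = 1"
    "tangent \<alpha> s \<bullet> normal \<alpha> s = 0"
    "(tangent \<alpha> has_vector_derivative curvature \<alpha> s *\<^sub>R normal \<alpha> s) (at s)"
proof -
  have k: "curvature \<alpha> s \<noteq> 0" and sm: "smooth I \<alpha>"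
    using assms unfolding frenet_curve_def by auto
  have tt: "tangent \<alpha> x \<bullet> tangent \<alpha> x = 1" if "x \<in> I" for x
    using assms(2) that unfolding frenet_curve_def tangent_def by (simp add: norm_eq_1)
  then show "tangent \<alpha> s \<bullet> tangent \<alpha> s = 1" using assms by blast
  show "normal \<alpha> s \<bullet> normal \<alpha> s = 1"
    using k unfolding normal_def curvature_def
    by (simp add: dot_square_norm power2_eq_square field_simps)
  have "(D \<alpha> has_vector_derivative D (D \<alpha>) s) (at s)"
    using smooth_imp_has_vector_derivative[OF sm assms(3), of 1] by simp
  then show T': "(tangent \<alpha> has_vector_derivative curvature \<alpha> s *\<^sub>R normal \<alpha> s) (at s)"
    using k unfolding normal_def tangent_def by simp
  show "tangent \<alpha> s \<bullet> normal \<alpha> s = 0"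
    using has_vector_derivative_eq_0_if_constant_on_open
        [OF assms(1,3) tt has_vector_derivative_inner[OF T' T']] k
    by (simp add: inner_commute)
qed

text \<open>
  The norm is differentiable away from 0 only: this is where the curvature must not vanish.
\<close>

lemma normal_has_vector_derivative:
  assumes "frenet_curve I \<alpha>" "s \<in> I"
  obtains n' where "(normal \<alpha> has_vector_derivative n') (at s)"
proof -
  have k: "D (D \<alpha>) s \<noteq> 0" and sm: "smooth I \<alpha>"
    using assms unfolding frenet_curve_def curvature_def by auto
  have d: "D (D \<alpha>) differentiable (at s)"
    using sm[unfolded smooth_def, rule_format, of s 2] assms(2) by (simp add: numeral_2_eq_2)
  moreover have "(\<lambda>x. norm (D (D \<alpha>) x)) differentiable (at s)"
    using differentiable_chain_at[OF d differentiable_norm_at[OF k]] by (simp add: o_def)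
  ultimately have "(\<lambda>x. inverse (norm (D (D \<alpha>) x)) *\<^sub>R D (D \<alpha>) x) differentiable (at s)"
    using k by (intro differentiable_scaleR differentiable_inverse) auto
  then have "normal \<alpha> differentiable (at s)"
    unfolding normal_def[abs_def] curvature_def .
  then show ?thesis using that vector_derivative_works by blast
qed

text \<open>
  The derivative \<open>n'\<close> of the normal is determined by its components: differentiating \<open>N \<bullet> N = 1\<close>
  and \<open>T \<bullet> N = 0\<close> gives \<open>n' \<bullet> N = 0\<close> and \<open>n' \<bullet> T = - \<kappa>\<close>. Since \<open>T' \<times> N = 0\<close>, the derivative of
  \<open>B = T \<times> N\<close> is \<open>T \<times> n' = - (n' \<bullet> B) N\<close>, which identifies \<open>n' \<bullet> B\<close> with the torsion.
\<close>

lemma frenet_serret: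
  assumes "open I" "frenet_curve I \<alpha>" "s \<in> I"
  shows "(normal \<alpha> has_vector_derivative
            (torsion \<alpha> s *\<^sub>R binormal \<alpha> s - curvature \<alpha> s *\<^sub>R tangent \<alpha> s)) (at s)"
    and "(binormal \<alpha> has_vector_derivative (- torsion \<alpha> s *\<^sub>R normal \<alpha> s)) (at s)"
proof -
  note frame = frenet_frame_orthonormal[OF assms(1,2)]
  let ?T = "tangent \<alpha> s" and ?N = "normal \<alpha> s" and ?B = "binormal \<alpha> s"
  note fr = frame(1-3)[OF assms(3)]
  note T' = frame(4)[OF assms(3)]
  note frame3 = orthonormal_frame_expansion[OF fr, folded binormal_def]
  obtain n' where N': "(normal \<alpha> has_vector_derivative n') (at s)"
    using normal_has_vector_derivative assms by blast
  have n'N: "n' \<bullet> ?N = 0"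
    using has_vector_derivative_eq_0_if_constant_on_open
        [OF assms(1,3) frame(2) has_vector_derivative_inner[OF N' N']]
    by (simp add: inner_commute)
  have n'T: "n' \<bullet> ?T = - curvature \<alpha> s"
    using has_vector_derivative_eq_0_if_constant_on_open
        [OF assms(1,3) frame(3) has_vector_derivative_inner[OF T' N']] fr
    by (simp add: inner_commute)
  have n': "n' = (n' \<bullet> ?B) *\<^sub>R ?B - curvature \<alpha> s *\<^sub>R ?T"
    by (rule trans[OF frame3(1)[of n']]) (simp add: n'N n'T)
  have "?T \<times> n' = - (n' \<bullet> ?B) *\<^sub>R ?N"
    using frame3(3) by (subst n') (simp add: cross_mult_right Cross3.right_diff_distrib)
  then have B': "(binormal \<alpha> has_vector_derivative - (n' \<bullet> ?B) *\<^sub>R ?N) (at s)"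
    using has_vector_derivative_cross[OF T' N']
    unfolding binormal_def[abs_def] by (simp add: cross_mult_left)
  then have tau: "torsion \<alpha> s = n' \<bullet> ?B"
    unfolding torsion_def D_def using fr by (simp add: vector_derivative_at)
  show "(binormal \<alpha> has_vector_derivative (- torsion \<alpha> s *\<^sub>R ?N)) (at s)"
    using B' tau by simp
  show "(normal \<alpha> has_vector_derivative
            (torsion \<alpha> s *\<^sub>R ?B - curvature \<alpha> s *\<^sub>R ?T)) (at s)"
    using N' n' tau by simp
qed

text \<open>
  The direction is that of \<open>c T + B\<close> with \<open>c = \<tau> / \<kappa>\<close>, a positive multiple of the Darboux vector
  \<open>\<tau> T + \<kappa> B\<close>. For constant \<open>c\<close> the vector \<open>c T + B\<close> is constant, and its norm \<open>sqrt (c\<^sup>2 + 1)\<close>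
  is nonzero.
\<close>

lemma helix_imp_constant_slope:
  assumes "open_interval I" "helix I \<alpha>"
  obtains u c where "norm u = 1" "\<And>s. s \<in> I \<Longrightarrow> tangent \<alpha> s \<bullet> u = c"
proof -
  have op: "open I" and fc: "frenet_curve I \<alpha>"
    using assms unfolding open_interval_def helix_def by auto
  obtain c where c: "\<And>s. s \<in> I \<Longrightarrow> torsion \<alpha> s / curvature \<alpha> s = c"
    using assms(2) unfolding helix_def by blast
  have "((\<lambda>s. c *\<^sub>R tangent \<alpha> s + binormal \<alpha> s) has_vector_derivative 0) (at s)"
    if s: "s \<in> I" for s
  proof -
    have tau: "torsion \<alpha> s = c * curvature \<alpha> s"
      using c[OF s] fc s unfolding frenet_curve_def by (auto simp: field_simps)
    show ?thesis
      using frenet_frame_orthonormal(4)[OF op fc s] frenet_serret(2)[OF op fc s]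
      by (auto intro!: derivative_eq_intros simp: tau)
  qed
  then obtain v where v: "\<And>s. s \<in> I \<Longrightarrow> c *\<^sub>R tangent \<alpha> s + binormal \<alpha> s = v"
    using constant_if_has_vector_derivative_0[OF assms(1)] by blast
  have Tv: "tangent \<alpha> s \<bullet> v = c" and vv: "v \<bullet> v = c\<^sup>2 + 1" if s: "s \<in> I" for s
    using frenet_frame_orthonormal(1-3)[OF op fc s]
      orthonormal_frame_expansion(2)[OF frenet_frame_orthonormal(1-3)[OF op fc s]]
    by (simp_all flip: v[OF s] add: binormal_def inner_simps inner_commute dot_cross_self
        power2_eq_square)
  obtain s0 where "s0 \<in> I" using assms(1) unfolding open_interval_def by blast
  then have "v \<bullet> v > 0" using vv[of s0] by (simp add: add_nonneg_pos)
  then have "v \<noteq> 0" by auto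
  show ?thesis
  proof (rule that)
    show "norm (v /\<^sub>R norm v) = 1" using \<open>v \<noteq> 0\<close> by simp
    show "tangent \<alpha> s \<bullet> (v /\<^sub>R norm v) = c / norm v" if "s \<in> I" for s
      using Tv[OF that] by (simp add: divide_inverse_commute)
  qed
qed

text \<open>
  In the frame, \<open>u = a T + b B\<close> with constant \<open>a\<close> and \<open>b\<close>, and \<open>\<tau> b = \<kappa> a\<close>. The quotient
  \<open>\<tau> / \<kappa> = a / b\<close> makes sense because \<open>b = 0\<close> would give \<open>\<kappa> a = 0\<close>, so \<open>a = 0\<close> and hence \<open>u = 0\<close>.
\<close>

lemma constant_slope_imp_helix:
  assumes "open_interval I" "frenet_curve I \<alpha>"
    and "norm u = 1" and slope: "\<And>s. s \<in> I \<Longrightarrow> tangent \<alpha> s \<bullet> u = a"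
  shows "helix I \<alpha>"
proof -
  have op: "open I" using assms(1) unfolding open_interval_def by blast
  have k: "curvature \<alpha> s \<noteq> 0" if "s \<in> I" for s
    using assms(2) that unfolding frenet_curve_def by auto
  note const = has_vector_derivative_const[of u]
  have Nu: "normal \<alpha> s \<bullet> u = 0" if s: "s \<in> I" for s
    using has_vector_derivative_eq_0_if_constant_on_open[OF op s slope
        has_vector_derivative_inner[OF frenet_frame_orthonormal(4)[OF op assms(2) s] const]] k[OF s]
    by simp
  have "((\<lambda>s. binormal \<alpha> s \<bullet> u) has_vector_derivative 0) (at s)" if s: "s \<in> I" for s
    using has_vector_derivative_inner[OF frenet_serret(2)[OF op assms(2) s] const] Nu[OF s]
    by simp
  then obtain b where b: "\<And>s. s \<in> I \<Longrightarrow> binormal \<alpha> s \<bullet> u = b"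
    using constant_if_has_vector_derivative_0[OF assms(1)] by blast
  have tau: "torsion \<alpha> s * b = curvature \<alpha> s * a" if s: "s \<in> I" for s
    using has_vector_derivative_eq_0_if_constant_on_open[OF op s Nu
        has_vector_derivative_inner[OF frenet_serret(1)[OF op assms(2) s] const]]
      b[OF s] slope[OF s]
    by (simp add: inner_diff_left)
  have "b \<noteq> 0" if s: "s \<in> I" for s
  proof
    assume "b = 0"
    then have "a = 0" using tau[OF s] k[OF s] by simp
    have "u \<bullet> tangent \<alpha> s = 0" "u \<bullet> normal \<alpha> s = 0" "u \<bullet> (tangent \<alpha> s \<times> normal \<alpha> s) = 0"
      using Nu[OF s] b[OF s] slope[OF s] \<open>a = 0\<close> \<open>b = 0\<close>
      by (simp_all add: inner_commute binormal_def)
    then have "u = 0"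
      by (subst orthonormal_frame_expansion(1)
          [OF frenet_frame_orthonormal(1-3)[OF op assms(2) s], of u]) simp
    then show False using assms(3) by simp
  qed
  then have "torsion \<alpha> s / curvature \<alpha> s = a / b" if "s \<in> I" for s
    using tau[OF that] k[OF that] that by (simp add: field_simps)
  then show ?thesis unfolding helix_def using assms(2) by blast
qed

text \<open>
  Constant angle of the normal of \<open>\<gamma>\<close> and constant slope of the tangent of \<open>\<alpha>\<close> are the same
  condition, since any constant value \<open>c\<close> of \<open>T \<bullet> u\<close> with unit \<open>T\<close> and \<open>u\<close> is \<open>cos (arccos c)\<close>.
\<close>

lemma slant_helix_evolute_iff_helix:
  assumes "open_interval I" "frenet_curve I \<alpha>" "evolute_direction_curve I \<alpha> \<gamma>"
  shows "slant_helix I \<gamma> \<longleftrightarrow> helix I \<alpha>"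
proof
  have N: "normal \<gamma> s = tangent \<alpha> s" if "s \<in> I" for s
    using assms(3) that unfolding evolute_direction_curve_def by blast
  {
    assume "slant_helix I \<gamma>"
    then show "helix I \<alpha>"
      unfolding slant_helix_def using constant_slope_imp_helix[OF assms(1,2)] N by metis
  next
    assume "helix I \<alpha>"
    then obtain u c where u: "norm u = 1" and c: "\<And>s. s \<in> I \<Longrightarrow> tangent \<alpha> s \<bullet> u = c"
      using helix_imp_constant_slope[OF assms(1)] by blast
    obtain s0 where s0: "s0 \<in> I" using assms(1) unfolding open_interval_def by blast
    have "\<bar>c\<bar> \<le> 1"
      using Cauchy_Schwarz_ineq2[of "tangent \<alpha> s0" u] c[OF s0] u assms(2) s0
      unfolding frenet_curve_def tangent_def by simp
    then have "cos (arccos c) = c" "0 \<le> arccos c" "arccos c \<le> pi"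
      by (auto intro: cos_arccos arccos_lbound arccos_ubound simp: abs_le_iff)
    then show "slant_helix I \<gamma>"
      using assms(3) u c N unfolding slant_helix_def evolute_direction_curve_def by metis
  }
qed

theorem theorem3p7:
  fixes I :: "real set" and \<alpha> \<beta> :: "real \<Rightarrow> real ^ 3"
  assumes "open_interval I"
    and "frenet_curve I \<alpha>"
    and "evolute_direction_curve I \<alpha> \<beta>"
  shows "(helix I \<alpha> \<longleftrightarrow> (\<exists>\<gamma>. slant_helix I \<gamma> \<and> involute_donor_curve I \<gamma> \<alpha>)) \<and>
         ((\<exists>\<gamma>. slant_helix I \<gamma> \<and> involute_donor_curve I \<gamma> \<alpha>) \<longleftrightarrow>
            (\<forall>\<gamma>. evolute_direction_curve I \<alpha> \<gamma> \<longrightarrow> slant_helix I \<gamma>))"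
  using slant_helix_evolute_iff_helix[OF assms(1,2)] assms(3)
  unfolding involute_donor_curve_def by blast

end
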